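(* Let $\sigma \colon [0,l] \to X_{\mathrm{valid}}$ be a path in $\Sigma$ whose arc length $l$ is lower bounded by a real number $l_{\mathrm{lb}}$ with $0 \leq l_{\mathrm{lb}} \leq l$. Let $\delta_1$ be the clearance of the start or of the goal state of the path, i.e., $\delta_1 = \delta(\sigma(0))$ or $\delta_1 = \delta(\sigma(l))$. Then, in either case, the reciprocal clearance cost of $\sigma$ satisfies $$c(\sigma) \geq \ln\left( \frac{\delta_1 + l_{\mathrm{lb}}}{\delta_1} \right).$$
   Context: $X$ is a state space, taken to be a subset of a real normed vector space with norm $\|\cdot\|$. $X_{\mathrm{invalid}} \subseteq X$ is the (nonempty) subset of invalid states and $X_{\mathrm{valid}} := X \setminus X_{\mathrm{invalid}}$ is the subset of valid states. The clearance of a valid state is $\delta(\mathbf{x}) := \min_{\mathbf{x}' \in X_{\mathrm{invalid}}} \|\mathbf{x} - \mathbf{x}'\|$; it is assumed that this minimum is attained and is strictly positive for every valid state, so $\delta \colon X_{\mathrm{valid}} \to (0,\infty)$. A path is a continuous function $\sigma \colon [0,l] \to X_{\mathrm{valid}}$ with $0 \leq l < \infty$, parameterized by arc length: for all $0 \leq s \leq t \leq l$ the restriction of $\sigma$ to $[s,t]$ has length $t-s$ with respect to $\|\cdot\|$. The number $l$ is the arc length of $\sigma$. $\Sigma$ denotes the set of all such paths. The reciprocal clearance cost of $\sigma \in \Sigma$ is $c(\sigma) := \int_0^l \frac{1}{\delta(\sigma(t))}\,dt$. *)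

theory Defs
  imports "HOL-Analysis.Analysis"
begin

(* LEAST is only meaningful where the minimum is attained. *)
definition clearance :: "'a::real_normed_vector set \<Rightarrow> 'a \<Rightarrow> real" where
  "clearance Xinvalid x = (LEAST d. d \<in> (\<lambda>x'. norm (x - x')) ` Xinvalid)"

lemma clearance_eq_infdist:
  assumes "x' \<in> Xinvalid" and "\<And>y. y \<in> Xinvalid \<Longrightarrow> norm (x - x') \<le> norm (x - y)"
  shows "clearance Xinvalid x = norm (x - x')" and "clearance Xinvalid x = infdist x Xinvalid"
proof -
  show 1: "clearance Xinvalid x = norm (x - x')"
    unfolding clearance_def using assms by (intro Least_equality) auto
  have "infdist x Xinvalid = norm (x - x')"
    unfolding infdist_def dist_norm
    using assms by (auto intro!: cInf_eq_minimum)
  with 1 show "clearance Xinvalid x = infdist x Xinvalid" by simp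
qed

(* Length of the restriction of \<sigma> to [s,t]: the supremum of the lengths of inscribed polygons
   with breakpoints s = p 0 \<le> ... \<le> p n = t. *)
definition curve_length :: "(real \<Rightarrow> 'a::real_normed_vector) \<Rightarrow> real \<Rightarrow> real \<Rightarrow> ereal" where
  "curve_length \<sigma> s t =
     Sup {ereal (\<Sum>i<n. norm (\<sigma> (p (Suc i)) - \<sigma> (p i))) | (n :: nat) (p :: nat \<Rightarrow> real).
            p 0 = s \<and> p n = t \<and> (\<forall>i<n. p i \<le> p (Suc i))}"

(* A path [0,l] \<rightarrow> X - Xinvalid is represented by the pair (l, \<sigma>); the values of \<sigma>
   outside [0,l] are irrelevant. *)
definition arc_length_paths ::
    "'a::real_normed_vector set \<Rightarrow> 'a set \<Rightarrow> (real \<times> (real \<Rightarrow> 'a)) set" where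
  "arc_length_paths X Xinvalid =
     {(l, \<sigma>). 0 \<le> l \<and> continuous_on {0..l} \<sigma> \<and> \<sigma> ` {0..l} \<subseteq> X - Xinvalid \<and>
        (\<forall>s t. 0 \<le> s \<and> s \<le> t \<and> t \<le> l \<longrightarrow> curve_length \<sigma> s t = ereal (t - s))}"

(* For paths in arc_length_paths the integrand is continuous on [0,l] when all clearances of valid
   states are attained and positive, so the integral exists. *)
definition reciprocal_clearance_cost ::
    "'a::real_normed_vector set \<Rightarrow> real \<Rightarrow> (real \<Rightarrow> 'a) \<Rightarrow> real" where
  "reciprocal_clearance_cost Xinvalid l \<sigma> = integral {0..l} (\<lambda>t. 1 / clearance Xinvalid (\<sigma> t))"

end

theory Submission
  imports Defs
begin

text \<open>Distance to the invalid set is 1-Lipschitz, and chords are no longer than arcs. Hence the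
  clearance at parameter \<open>t\<close> is at most \<open>\<delta>\<^sub>1 + t\<close>, respectively \<open>\<delta>\<^sub>1 + (l - t)\<close> when \<open>\<delta>\<^sub>1\<close> is the
  clearance of the goal, and the cost dominates the integral of the reciprocal of this bound.\<close>

text \<open>The chord is itself an inscribed polygon, the one with a single segment
  (\<open>n = 1\<close>), so it lies below the supremum.\<close>

lemma norm_le_curve_length:
  assumes "s \<le> t"
  shows "ereal (norm (\<sigma> t - \<sigma> s)) \<le> curve_length \<sigma> s t"
proof -
  let ?p = "\<lambda>i::nat. if i = 0 then s else t"
  have "\<exists>(n::nat) p. ereal (norm (\<sigma> t - \<sigma> s)) = ereal (\<Sum>i<n. norm (\<sigma> (p (Suc i)) - \<sigma> (p i)))
      \<and> p 0 = s \<and> p n = t \<and> (\<forall>i<n. p i \<le> p (Suc i))"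
    by (rule exI[of _ 1], rule exI[of _ ?p]) (simp add: assms)
  then show ?thesis
    unfolding curve_length_def by (intro Sup_upper) simp
qed

text \<open>Parameterization by arc length turns the chord bound into a 1-Lipschitz bound; the
  symmetric form serves both the start and the goal as reference point.\<close>

lemma arc_length_paths_norm_le:
  assumes "(l, \<sigma>) \<in> arc_length_paths X Xinvalid" and "s \<in> {0..l}" and "t \<in> {0..l}"
  shows "norm (\<sigma> s - \<sigma> t) \<le> \<bar>s - t\<bar>"
proof -
  have *: "norm (\<sigma> b - \<sigma> a) \<le> b - a" if "0 \<le> a" "a \<le> b" "b \<le> l" for a b
  proof -
    have "curve_length \<sigma> a b = ereal (b - a)"
      using assms(1) that by (simp add: arc_length_paths_def)
    then show ?thesis
      using norm_le_curve_length[OF that(2), of \<sigma>] by simp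
  qed
  show ?thesis
    using *[of s t] *[of t s] assms(2,3) by (cases "s \<le> t") (auto simp: norm_minus_commute)
qed

text \<open>The fundamental theorem of calculus evaluates the integral of the minorant
  \<open>g\<close>, and integrals are monotone. In the application \<open>G\<close> is a
  logarithm.\<close>

lemma integral_ge_of_deriv_le:
  fixes f G g :: "real \<Rightarrow> real"
  assumes "a \<le> b" and "f integrable_on {a..b}"
    and deriv: "\<And>t. t \<in> {a..b} \<Longrightarrow> (G has_real_derivative g t) (at t)"
    and "\<And>t. t \<in> {a..b} \<Longrightarrow> g t \<le> f t"
  shows "G b - G a \<le> integral {a..b} f"
proof -
  have "(g has_integral (G b - G a)) {a..b}"
    using assms(1) deriv
    by (intro fundamental_theorem_of_calculus)
      (auto simp flip: has_real_derivative_iff_has_vector_derivative intro: DERIV_subset)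
  then show ?thesis
    using assms(2,4) by (intro has_integral_le[OF _ integrable_integral])
qed

theorem lemma2:
  fixes X Xinvalid :: "'a::real_normed_vector set"
    and \<sigma> :: "real \<Rightarrow> 'a"
    and l l_lb \<delta>\<^sub>1 :: real
  assumes invalid_subset: "Xinvalid \<subseteq> X"
    and invalid_nonempty: "Xinvalid \<noteq> {}"
    and clearance_attained:
      "\<And>x. x \<in> X - Xinvalid \<Longrightarrow> \<exists>x'\<in>Xinvalid. \<forall>y\<in>Xinvalid. norm (x - x') \<le> norm (x - y)"
    and clearance_pos: "\<And>x. x \<in> X - Xinvalid \<Longrightarrow> 0 < clearance Xinvalid x"
    and path: "(l, \<sigma>) \<in> arc_length_paths X Xinvalid"
    and l_lb: "0 \<le> l_lb" "l_lb \<le> l"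
    and delta1: "\<delta>\<^sub>1 = clearance Xinvalid (\<sigma> 0) \<or> \<delta>\<^sub>1 = clearance Xinvalid (\<sigma> l)"
  shows "reciprocal_clearance_cost Xinvalid l \<sigma> \<ge> ln ((\<delta>\<^sub>1 + l_lb) / \<delta>\<^sub>1)"
proof -
  define f where "f t = clearance Xinvalid (\<sigma> t)" for t
  have l0: "0 \<le> l" and cont: "continuous_on {0..l} \<sigma>"
    and valid: "\<And>t. t \<in> {0..l} \<Longrightarrow> \<sigma> t \<in> X - Xinvalid"
    using path by (auto simp: arc_length_paths_def image_subset_iff)
  \<comment> \<open>Attainment of the minimum gives the \<open>LEAST\<close> its meaning;
    \<open>infdist\<close> then supplies the triangle inequality and continuity.\<close>
  have f_eq: "f t = infdist (\<sigma> t) Xinvalid" if t: "t \<in> {0..l}" for t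
    using clearance_attained[OF valid[OF t]] clearance_eq_infdist(2) unfolding f_def by metis
  have f_pos: "0 < f t" if "t \<in> {0..l}" for t
    using clearance_pos[OF valid[OF that]] by (simp add: f_def)
  have f_le: "f t \<le> f s + \<bar>s - t\<bar>" if "s \<in> {0..l}" "t \<in> {0..l}" for s t
    using infdist_triangle[of "\<sigma> t" Xinvalid "\<sigma> s"] arc_length_paths_norm_le[OF path that(2,1)] that
    by (simp add: f_eq dist_norm abs_minus_commute)
  have "continuous_on {0..l} f"
    using continuous_on_infdist[OF cont, of Xinvalid] by (rule continuous_on_eq) (simp add: f_eq)
  \<comment> \<open>Integrability matters because \<open>integral\<close> is 0 by default on
    functions that are not integrable.\<close>
  then have int: "(\<lambda>t. 1 / f t) integrable_on {0..l}"
    by (intro integrable_continuous_real continuous_intros) (use f_pos in force)+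
  have d_pos: "0 < \<delta>\<^sub>1"
    using delta1 f_pos[of 0] f_pos[of l] l0 by (auto simp: f_def)
  have "ln (\<delta>\<^sub>1 + l) - ln \<delta>\<^sub>1 \<le> integral {0..l} (\<lambda>t. 1 / f t)"
    using delta1
  proof
    assume "\<delta>\<^sub>1 = clearance Xinvalid (\<sigma> 0)"
    then have "f t \<le> \<delta>\<^sub>1 + t" if "t \<in> {0..l}" for t
      using f_le[of 0 t] that l0 by (simp add: f_def)
    \<comment> \<open>The summand 0 exhibits the left side as \<open>G l - G 0\<close> with
      \<open>G t = ln (\<delta>\<^sub>1 + t)\<close>.\<close>
    then have "ln (\<delta>\<^sub>1 + l) - ln (\<delta>\<^sub>1 + 0) \<le> integral {0..l} (\<lambda>t. 1 / f t)"
      using l0 int d_pos f_pos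
      by (intro integral_ge_of_deriv_le[where g = "\<lambda>t. 1 / (\<delta>\<^sub>1 + t)"])
        (force intro!: derivative_eq_intros frac_le)+
    then show ?thesis by simp
  next
    assume "\<delta>\<^sub>1 = clearance Xinvalid (\<sigma> l)"
    then have "f t \<le> \<delta>\<^sub>1 + (l - t)" if "t \<in> {0..l}" for t
      using f_le[of l t] that l0 by (simp add: f_def)
    \<comment> \<open>Here \<open>G t = - ln (\<delta>\<^sub>1 + (l - t))\<close>: the outer minus
      cancels the inner derivative -1. The terms \<open>l - l\<close> and \<open>l - 0\<close> keep
      the shape \<open>G l - G 0\<close>.\<close>
    then have "- ln (\<delta>\<^sub>1 + (l - l)) - - ln (\<delta>\<^sub>1 + (l - 0)) \<le> integral {0..l} (\<lambda>t. 1 / f t)"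
      using l0 int d_pos f_pos
      by (intro integral_ge_of_deriv_le[where g = "\<lambda>t. 1 / (\<delta>\<^sub>1 + (l - t))"])
        (force intro!: derivative_eq_intros frac_le)+
    then show ?thesis by simp
  qed
  \<comment> \<open>The integral bound uses the true length \<open>l\<close>; monotonicity of
    \<open>ln\<close> weakens it to \<open>l_lb\<close>.\<close>
  moreover have "ln ((\<delta>\<^sub>1 + l_lb) / \<delta>\<^sub>1) \<le> ln (\<delta>\<^sub>1 + l) - ln \<delta>\<^sub>1"
    using d_pos l_lb by (simp add: ln_div)
  ultimately show ?thesis
    by (simp add: reciprocal_clearance_cost_def f_def)
qed

end
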